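(* Let $\mathcal P=(X,\prec)$ be a poset on $|X|=n$ elements, and let $\mathcal L$ be the set of feasible words of the corresponding poset antimatroid. Let $\omega:X\to\mathbb R_{>0}$ be a positive weight function satisfying $\omega(x)\ge\sum_{y\in\mathrm{Cov}(x)}\omega(y)$ for all $x\in X$, and fix an integer $1\le k<n$. Then $$\mathrm L_\omega(k)^2\ =\ \mathrm L_\omega(k-1)\cdot \mathrm L_\omega(k+1)$$ if and only if there exists a constant $s>0$ such that for every $\alpha\in\mathcal L_{k-1}$ and every $x\in\mathrm{Cont}(\alpha)$ the following three conditions hold: (1) $\sum_{y\in\mathrm{Cont}(\alpha)}\omega(y)=s$; (2) $\mathrm{Des}_\alpha(x)=\mathrm{Cov}(x)$; (3) $\sum_{y\in\mathrm{Cov}(x)}\omega(y)=\omega(x)$.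
   Context: Words are finite sequences of elements (letters) of $X$; a word is simple if no letter occurs twice. A simple word $\alpha$ is feasible if whenever $\alpha$ contains $x$ and $y\prec x$, the letter $y$ occurs in $\alpha$ before $x$. The poset antimatroid of $\mathcal P$ is $(X,\mathcal L)$ with $\mathcal L$ the set of all feasible words (including the empty word). $\mathrm{Cov}(x)$ is the set of elements $y$ covering $x$ in $\mathcal P$. Put $\mathcal L_k=\{\alpha\in\mathcal L:|\alpha|=k\}$, $\omega(\alpha)=\prod_{x\in\alpha}\omega(x)$, and $\mathrm L_\omega(k)=\sum_{\alpha\in\mathcal L_k}\omega(\alpha)$. For $\alpha\in\mathcal L$: $\mathrm{Cont}(\alpha)=\{x\in X:\alpha x\in\mathcal L\}$, and for $x\in\mathrm{Cont}(\alpha)$, $\mathrm{Des}_\alpha(x)=\{y\in X:\alpha xy\in\mathcal L,\ \alpha y\notin\mathcal L\}$. *)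

theory Defs
  imports Complex_Main
begin

text \<open>
  A finite poset is given by its ground set \<open>X\<close> and its strict order \<open>R\<close>, where \<open>R y x\<close> means that
  \<open>y\<close> is strictly below \<open>x\<close>. All definitions look at \<open>R\<close> on \<open>X\<close> only. Words over \<open>X\<close> are lists,
  and appending a letter on the right is \<open>\<alpha> @ [x]\<close>.
\<close>

definition strict_poset_on :: "'a set \<Rightarrow> ('a \<Rightarrow> 'a \<Rightarrow> bool) \<Rightarrow> bool" where
  "strict_poset_on X R \<longleftrightarrow> irreflp_on X R \<and> transp_on X R"

definition Cov :: "'a set \<Rightarrow> ('a \<Rightarrow> 'a \<Rightarrow> bool) \<Rightarrow> 'a \<Rightarrow> 'a set" where
  "Cov X R x = {y \<in> X. R x y \<and> \<not> (\<exists>z\<in>X. R x z \<and> R z y)}"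

definition feasible :: "'a set \<Rightarrow> ('a \<Rightarrow> 'a \<Rightarrow> bool) \<Rightarrow> 'a list \<Rightarrow> bool" where
  "feasible X R \<alpha> \<longleftrightarrow> set \<alpha> \<subseteq> X \<and> distinct \<alpha> \<and>
     (\<forall>i<length \<alpha>. \<forall>y\<in>X. R y (\<alpha> ! i) \<longrightarrow> (\<exists>j<i. \<alpha> ! j = y))"

definition feasible_words :: "'a set \<Rightarrow> ('a \<Rightarrow> 'a \<Rightarrow> bool) \<Rightarrow> 'a list set" where
  "feasible_words X R = {\<alpha>. feasible X R \<alpha>}"

definition feasible_words_of_length :: "'a set \<Rightarrow> ('a \<Rightarrow> 'a \<Rightarrow> bool) \<Rightarrow> nat \<Rightarrow> 'a list set" where
  "feasible_words_of_length X R k = {\<alpha> \<in> feasible_words X R. length \<alpha> = k}"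

definition word_weight :: "('a \<Rightarrow> real) \<Rightarrow> 'a list \<Rightarrow> real" where
  "word_weight \<omega> \<alpha> = (\<Prod>x\<leftarrow>\<alpha>. \<omega> x)"

definition L_weight :: "'a set \<Rightarrow> ('a \<Rightarrow> 'a \<Rightarrow> bool) \<Rightarrow> ('a \<Rightarrow> real) \<Rightarrow> nat \<Rightarrow> real" where
  "L_weight X R \<omega> k = (\<Sum>\<alpha>\<in>feasible_words_of_length X R k. word_weight \<omega> \<alpha>)"

definition Cont :: "'a set \<Rightarrow> ('a \<Rightarrow> 'a \<Rightarrow> bool) \<Rightarrow> 'a list \<Rightarrow> 'a set" where
  "Cont X R \<alpha> = {x \<in> X. \<alpha> @ [x] \<in> feasible_words X R}"

definition Des :: "'a set \<Rightarrow> ('a \<Rightarrow> 'a \<Rightarrow> bool) \<Rightarrow> 'a list \<Rightarrow> 'a \<Rightarrow> 'a set" where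
  "Des X R \<alpha> x = {y \<in> X. \<alpha> @ [x, y] \<in> feasible_words X R \<and> \<alpha> @ [y] \<notin> feasible_words X R}"

end

theory Submission
  imports Defs
begin

text \<open>
  Fix an ideal \<open>I\<close> and collect the weights of the continuations \<open>xy\<beta>\<close>, \<open>x\<beta>\<close>, \<open>\<beta>\<close> with \<open>|\<beta>| = m\<close> in a
  symmetric matrix indexed by the available letters and one extra index. Log-concavity of the weight
  sequence is the reversed Cauchy-Schwarz inequality for two vectors, so it suffices that all these
  matrices have only one positive direction. This goes by induction on \<open>m\<close> (the combinatorial atlas
  of Chan and Pak): the rows of a matrix are values of the forms belonging to \<open>I \<union> {x}\<close> and smaller
  \<open>m\<close>, and a Bochner-type argument passes from these forms to the next one. The condition on the
  weights enters only at \<open>m = 0\<close>, where the form is a square minus a nonnegative diagonal form.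

  If equality holds with ratio \<open>s\<close>, the vector \<open>1 - s e\<close> (\<open>e\<close> the extra unit vector) lies in the
  kernel of the form. Reading this row by row, the same ratio \<open>s\<close> holds after each feasible first
  letter, hence after every feasible word of length \<open>k - 1\<close>. There only words of length one and two
  remain, and equality can be read off directly.
\<close>

subsection \<open>Symmetric forms with one positive direction\<close>

definition bil :: "'i set \<Rightarrow> ('i \<Rightarrow> 'i \<Rightarrow> real) \<Rightarrow> ('i \<Rightarrow> real) \<Rightarrow> ('i \<Rightarrow> real) \<Rightarrow> real" where
  "bil S a v w = (\<Sum>i\<in>S. \<Sum>j\<in>S. v i * a i j * w j)"

definition symmetric_on :: "'i set \<Rightarrow> ('i \<Rightarrow> 'i \<Rightarrow> real) \<Rightarrow> bool" where
  "symmetric_on S a \<longleftrightarrow> (\<forall>i\<in>S. \<forall>j\<in>S. a i j = a j i)"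

text \<open>For a symmetric form this means at most one positive eigenvalue. The reversed
  Cauchy-Schwarz form of it survives limits and needs no diagonalisation.\<close>

definition hyperbolic :: "'i set \<Rightarrow> ('i \<Rightarrow> 'i \<Rightarrow> real) \<Rightarrow> bool" where
  "hyperbolic S a \<longleftrightarrow> (\<forall>v w. 0 < bil S a w w \<longrightarrow> bil S a v v * bil S a w w \<le> (bil S a v w)\<^sup>2)"

lemma bil_commute: "symmetric_on S a \<Longrightarrow> bil S a v w = bil S a w v"
  unfolding bil_def
  by (subst sum.swap) (auto simp: symmetric_on_def mult_ac intro!: sum.cong)

lemma bil_add_left: "bil S a (\<lambda>i. u i + v i) w = bil S a u w + bil S a v w"
  by (simp add: bil_def algebra_simps sum.distrib)

lemma bil_add_right: "bil S a w (\<lambda>i. u i + v i) = bil S a w u + bil S a w v"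
  by (simp add: bil_def algebra_simps sum.distrib)

lemma bil_scale_left: "bil S a (\<lambda>i. c * v i) w = c * bil S a v w"
  by (simp add: bil_def algebra_simps sum_distrib_left)

lemma bil_scale_right: "bil S a w (\<lambda>i. c * v i) = c * bil S a w v"
  by (simp add: bil_def algebra_simps sum_distrib_left)

lemma bil_combine:
  assumes "symmetric_on S a"
  shows "bil S a (\<lambda>i. c * v i + d * w i) (\<lambda>i. c * v i + d * w i) =
    c\<^sup>2 * bil S a v v + 2 * c * d * bil S a v w + d\<^sup>2 * bil S a w w"
  using bil_commute[OF assms, of w v]
  by (simp add: bil_add_left bil_add_right bil_scale_left bil_scale_right power2_eq_square algebra_simps)

lemma bil_matrix_combine:
  "bil S (\<lambda>i j. c * a i j + d * b i j) v w = c * bil S a v w + d * bil S b v w"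
  by (simp add: bil_def algebra_simps sum.distrib sum_distrib_left)

lemma bil_rows: "bil S a v w = (\<Sum>i\<in>S. v i * (\<Sum>j\<in>S. a i j * w j))"
  by (simp add: bil_def sum_distrib_left mult.assoc)

text \<open>One positive vector \<open>h\<close> suffices as a witness: the form is nonpositive on
  the orthogonal complement of \<open>h\<close>, and some combination of \<open>v\<close> and
  \<open>w\<close> lies there.\<close>

lemma hyperbolicI:
  assumes sym: "symmetric_on S a" and hpos: "0 < bil S a h h"
    and rcs: "\<And>v. bil S a v v * bil S a h h \<le> (bil S a v h)\<^sup>2"
  shows "hyperbolic S a"
  unfolding hyperbolic_def
proof (intro allI impI)
  fix v w assume wpos: "0 < bil S a w w"
  define p q where "p = bil S a v h" and "q = bil S a w h"
  define z where "z = (\<lambda>i. p * w i + (- q) * v i)"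
  have "0 < q\<^sup>2"
    using rcs[of w] wpos hpos unfolding q_def by (smt (verit) mult_pos_pos)
  have "bil S a z h = 0"
    by (simp only: z_def bil_add_left bil_scale_left) (simp add: p_def q_def)
  then have "bil S a z z * bil S a h h \<le> 0" using rcs[of z] by simp
  then have "bil S a z z \<le> 0" using hpos by (simp add: mult_le_0_iff)
  then have le: "p\<^sup>2 * bil S a w w - 2 * p * q * bil S a v w + q\<^sup>2 * bil S a v v \<le> 0"
    unfolding z_def using bil_combine[OF sym, of p w "-q" v] bil_commute[OF sym, of w v] by simp
  \<comment> \<open>Completing the square turns the sign of the form at \<open>z\<close> into the
    claim, up to the positive factor \<open>q\<^sup>2\<close>.\<close>
  have "q\<^sup>2 * (bil S a v v * bil S a w w - (bil S a v w)\<^sup>2) =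
      bil S a w w * (p\<^sup>2 * bil S a w w - 2 * p * q * bil S a v w + q\<^sup>2 * bil S a v v)
      - (p * bil S a w w - q * bil S a v w)\<^sup>2"
    by (simp add: power2_eq_square algebra_simps)
  also have "\<dots> \<le> 0"
    using mult_nonneg_nonpos[OF less_imp_le[OF wpos] le] zero_le_power2[of "p * bil S a w w - q * bil S a v w"]
    by linarith
  finally show "bil S a v v * bil S a w w \<le> (bil S a v w)\<^sup>2"
    using \<open>0 < q\<^sup>2\<close> by (simp add: mult_le_0_iff)
qed

text \<open>Positivity at \<open>w\<close> is an open condition and the inequality a closed one, so
  both can be followed as t tends to 1 from below.\<close>

lemma hyperbolic_limit:
  assumes "\<And>t. 0 < t \<Longrightarrow> t < 1 \<Longrightarrow> hyperbolic S (\<lambda>i j. t * a i j + (1 - t) * b i j)"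
  shows "hyperbolic S a"
  unfolding hyperbolic_def
proof (intro allI impI)
  fix v w assume pos: "0 < bil S a w w"
  let ?f = "\<lambda>t v w. t * bil S a v w + (1 - t) * bil S b v w"
  have lim: "((\<lambda>t. ?f t v w) \<longlongrightarrow> bil S a v w) (at_left 1)" for v w
    by (rule tendsto_eq_intros refl | simp)+
  have ev: "\<forall>\<^sub>F t in at_left 1. ?f t v v * ?f t w w \<le> (?f t v w)\<^sup>2"
  proof -
    have "\<forall>\<^sub>F t::real in at_left 1. 0 < t \<and> t < 1"
      using eventually_at_left_real[of 0 1] by simp
    moreover have "\<forall>\<^sub>F t in at_left 1. 0 < ?f t w w"
      using order_tendstoD(1)[OF lim pos] .
    ultimately show ?thesis
      by eventually_elim
        (use assms in \<open>auto simp: hyperbolic_def bil_matrix_combine\<close>)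
  qed
  show "bil S a v v * bil S a w w \<le> (bil S a v w)\<^sup>2"
    by (rule tendsto_le[OF _ tendsto_power[OF lim] tendsto_mult[OF lim lim] ev]) simp
qed

text \<open>On the orthogonal complement of \<open>w\<close> the form is negative semidefinite, and
  an isotropic vector of a semidefinite form lies in its kernel.\<close>

lemma hyperbolic_kernel:
  assumes sym: "symmetric_on S a" and hyp: "hyperbolic S a"
    and wpos: "0 < bil S a w w" and vw: "bil S a v w = 0" and vv: "bil S a v v = 0"
  shows "bil S a u v = 0"
proof -
  define c where "c = bil S a u w / bil S a w w"
  define y where "y = (\<lambda>i. 1 * u i + (- c) * w i)"
  have yw: "bil S a y w = 0"
    unfolding y_def bil_add_left bil_scale_left using wpos by (simp add: c_def)
  have yv: "bil S a y v = bil S a u v"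
    unfolding y_def bil_add_left bil_scale_left using vw bil_commute[OF sym, of w v] by simp
  \<comment> \<open>Moving from \<open>y\<close> along \<open>v\<close> stays orthogonal to
    \<open>w\<close>, and the form is affine in \<open>r\<close> because \<open>v\<close> is
    isotropic. An affine function bounded above has slope zero.\<close>
  have *: "bil S a y y + 2 * r * bil S a u v \<le> 0" for r
  proof -
    let ?z = "\<lambda>i. 1 * y i + r * v i"
    have "bil S a ?z w = 0"
      unfolding bil_add_left bil_scale_left using yw vw by simp
    then have "bil S a ?z ?z * bil S a w w \<le> 0"
      using hyp wpos unfolding hyperbolic_def by (metis zero_power2)
    then have "bil S a ?z ?z \<le> 0" using wpos by (simp add: mult_le_0_iff)
    then show ?thesis using bil_combine[OF sym, of 1 y r v] yv vv by simp
  qed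
  show ?thesis
  proof (rule ccontr)
    assume "bil S a u v \<noteq> 0"
    then show False
      using *[of "(1 - bil S a y y) / (2 * bil S a u v)"] by (simp add: field_simps)
  qed
qed

text \<open>With \<open>c = -1\<close> this is the Dirichlet form of the chain, used for the
  spectral gap; with \<open>c = 1\<close> it gives the lower bound -1 on the spectrum.\<close>

lemma sum_mult_square_add:
  assumes "finite S" "symmetric_on S b"
  shows "(\<Sum>i\<in>S. \<Sum>j\<in>S. b i j * (f i + c * f j)\<^sup>2) =
    (1 + c\<^sup>2) * (\<Sum>i\<in>S. (\<Sum>j\<in>S. b i j) * (f i)\<^sup>2) + 2 * c * bil S b f f"
proof -
  have *: "(\<Sum>i\<in>S. \<Sum>j\<in>S. b i j * (f j)\<^sup>2) = (\<Sum>i\<in>S. \<Sum>j\<in>S. b i j * (f i)\<^sup>2)"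
    by (subst sum.swap) (use assms in \<open>auto simp: symmetric_on_def intro!: sum.cong\<close>)
  have "(\<Sum>i\<in>S. \<Sum>j\<in>S. b i j * (f i + c * f j)\<^sup>2) =
     (\<Sum>i\<in>S. \<Sum>j\<in>S. b i j * (f i)\<^sup>2) + c\<^sup>2 * (\<Sum>i\<in>S. \<Sum>j\<in>S. b i j * (f j)\<^sup>2) + 2 * c * bil S b f f"
    by (simp add: bil_def sum.distrib[symmetric] sum_distrib_left power2_eq_square algebra_simps)
  then show ?thesis unfolding *
    by (simp add: sum_distrib_right algebra_simps)
qed

text \<open>With \<open>d\<close> the row sums of \<open>b\<close>, the operator \<open>P = d\<^sup>-\<^sup>1 b\<close> is a reversible Markov chain, and the
  hypothesis \<open>bochner\<close> reads \<open>P \<le> P\<^sup>2\<close>. The star centred at \<open>z\<close> gives a spectral gap; then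
  \<open>P \<le> c\<close> on the orthogonal complement of the constants improves to \<open>P \<le> c / (2 - c)\<close>, and
  iterating this yields \<open>P \<le> 0\<close> there without any spectral theorem.\<close>

lemma markov_hyperbolic:
  fixes b :: "'i \<Rightarrow> 'i \<Rightarrow> real" and S :: "'i set"
  defines "d \<equiv> \<lambda>i. \<Sum>j\<in>S. b i j"
  assumes fin: "finite S" and sym: "symmetric_on S b"
    and nonneg: "\<And>i j. i \<in> S \<Longrightarrow> j \<in> S \<Longrightarrow> 0 \<le> b i j"
    and z: "z \<in> S" and star: "\<And>i. i \<in> S \<Longrightarrow> 0 < b i z"
    and bochner: "\<And>f. bil S b f f \<le> (\<Sum>i\<in>S. (\<Sum>j\<in>S. b i j * f j)\<^sup>2 / d i)"
  shows "bil S b f f * bil S b (\<lambda>_. 1) (\<lambda>_. 1) \<le> (bil S b f (\<lambda>_. 1))\<^sup>2"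
proof -
  define N where "N = (\<lambda>f. \<Sum>i\<in>S. d i * (f i)\<^sup>2)"
  define P where "P = (\<lambda>f i. (\<Sum>j\<in>S. b i j * f j) / d i)"
  have dpos: "0 < d i" if "i \<in> S" for i
    unfolding d_def using that nonneg star[OF that] z fin by (intro sum_pos2[of _ z]) auto
  have N_nonneg: "0 \<le> N f" for f
    unfolding N_def using dpos by (intro sum_nonneg mult_nonneg_nonneg) (auto intro: less_imp_le)
  have bil_one: "bil S b f (\<lambda>_. 1) = (\<Sum>i\<in>S. d i * f i)" for f
    by (simp add: bil_rows d_def mult.commute)
  have one_bil: "bil S b (\<lambda>_. 1) f = (\<Sum>i\<in>S. d i * f i)" for f
    using bil_commute[OF sym] bil_one by metis
  have dP: "d i * P f i = (\<Sum>j\<in>S. b i j * f j)" if "i \<in> S" for i f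
    using dpos[OF that] by (simp add: P_def)
  have N_combine: "N (\<lambda>i. c * f i + e * P f i) = c\<^sup>2 * N f + 2 * c * e * bil S b f f + e\<^sup>2 * N (P f)" for c e f
  proof -
    have "bil S b f f = (\<Sum>i\<in>S. d i * f i * P f i)"
      unfolding bil_rows by (intro sum.cong) (auto simp: dP[symmetric])
    then show ?thesis
      by (simp add: N_def power2_eq_square algebra_simps sum.distrib sum_distrib_left)
  qed
  have bil_P: "bil S b f (P f) = N (P f)" for f
  proof -
    have "bil S b (P f) f = N (P f)"
      unfolding bil_rows N_def by (intro sum.cong) (auto simp: dP[symmetric] power2_eq_square)
    then show ?thesis using bil_commute[OF sym] by metis
  qed
  have bochner': "bil S b f f \<le> N (P f)" for f
  proof -
    have "N (P f) = (\<Sum>i\<in>S. (\<Sum>j\<in>S. b i j * f j)\<^sup>2 / d i)"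
      unfolding N_def using dpos
      by (intro sum.cong refl) (auto simp: P_def power2_eq_square)
    then show ?thesis using bochner by simp
  qed
  have contr: "0 \<le> N f + bil S b f f" for f
  proof -
    have "0 \<le> (\<Sum>i\<in>S. \<Sum>j\<in>S. b i j * (f i + 1 * f j)\<^sup>2)"
      using nonneg by (intro sum_nonneg mult_nonneg_nonneg) auto
    then show ?thesis unfolding sum_mult_square_add[OF fin sym] N_def d_def by simp
  qed
  define perp where "perp = (\<lambda>f. (\<Sum>i\<in>S. d i * f i) = 0)"
  have perp_P: "perp (P f)" if "perp f" for f
  proof -
    have "(\<Sum>i\<in>S. d i * P f i) = bil S b (\<lambda>_. 1) f"
      by (simp add: bil_rows dP)
    then show ?thesis using that unfolding perp_def one_bil by simp
  qed
  \<comment> \<open>A Doeblin constant: from every state the chain jumps to \<open>z\<close> with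
    probability at least \<open>\<epsilon>\<close>.\<close>
  obtain \<epsilon> where \<epsilon>: "0 < \<epsilon>" "\<And>i. i \<in> S \<Longrightarrow> \<epsilon> * d i \<le> b i z"
  proof
    let ?e = "Min ((\<lambda>i. b i z / d i) ` S)"
    show "0 < ?e" using fin z star dpos by (subst Min_gr_iff) auto
    show "?e * d i \<le> b i z" if "i \<in> S" for i
    proof -
      have "?e \<le> b i z / d i" using fin that by auto
      then show ?thesis using dpos[OF that] by (simp add: pos_le_divide_eq)
    qed
  qed
  \<comment> \<open>Keep only the edges into \<open>z\<close> in the Dirichlet form. For
    \<open>f\<close> orthogonal to the constants, the second moment about \<open>f z\<close> is at
    least \<open>N f\<close>.\<close>
  have gap: "bil S b f f \<le> (1 - \<epsilon> / 2) * N f" if "perp f" for f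
  proof -
    have "\<epsilon> * N f \<le> \<epsilon> * (N f + (f z)\<^sup>2 * (\<Sum>i\<in>S. d i))"
      using \<epsilon>(1) dpos by (intro mult_left_mono) (auto intro!: mult_nonneg_nonneg sum_nonneg intro: less_imp_le)
    also have "N f + (f z)\<^sup>2 * (\<Sum>i\<in>S. d i) = (\<Sum>i\<in>S. d i * (f i - f z)\<^sup>2) + 2 * f z * (\<Sum>i\<in>S. d i * f i)"
      by (simp add: N_def power2_eq_square algebra_simps sum.distrib sum_distrib_left sum_subtractf)
    also have "\<dots> = (\<Sum>i\<in>S. d i * (f i - f z)\<^sup>2)" using that by (simp add: perp_def)
    also have "\<epsilon> * \<dots> \<le> (\<Sum>i\<in>S. b i z * (f i - f z)\<^sup>2)"
      unfolding sum_distrib_left mult.assoc[symmetric] using \<epsilon>(2) by (intro sum_mono mult_right_mono) auto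
    also have "\<dots> \<le> (\<Sum>i\<in>S. \<Sum>j\<in>S. b i j * (f i + (-1) * f j)\<^sup>2)"
    proof (rule sum_mono)
      fix i assume "i \<in> S"
      then show "b i z * (f i - f z)\<^sup>2 \<le> (\<Sum>j\<in>S. b i j * (f i + (-1) * f j)\<^sup>2)"
        using member_le_sum[of z S "\<lambda>j. b i j * (f i - f j)\<^sup>2"] nonneg z fin by auto
    qed
    also have "\<dots> = 2 * N f - 2 * bil S b f f"
      unfolding sum_mult_square_add[OF fin sym] by (simp add: N_def d_def)
    finally show ?thesis by (simp add: algebra_simps)
  qed
  have improve: "bil S b f f * (2 - c) \<le> c * N f"
    if bound: "\<And>f. perp f \<Longrightarrow> bil S b f f \<le> c * N f" and c: "0 < c" and f: "perp f" for c f
  proof -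
    \<comment> \<open>\<open>bound\<close> is applied to f + P f and \<open>contr\<close> to c f - P
      f. In the sum of the two inequalities the cubic term \<open>?r\<close> cancels, and
      \<open>bochner'\<close> then bounds \<open>?q\<close> below by \<open>?p\<close>.\<close>
    let ?u = "\<lambda>i. 1 * f i + 1 * P f i" and ?w = "\<lambda>i. c * f i + (- 1) * P f i"
    let ?p = "bil S b f f" and ?q = "N (P f)" and ?r = "bil S b (P f) (P f)"
    have "perp ?u"
      using f perp_P[OF f] by (simp add: perp_def algebra_simps sum.distrib)
    then have "bil S b ?u ?u \<le> c * N ?u" by (rule bound)
    then have 1: "?p + 2 * ?q + ?r \<le> c * (N f + 2 * ?p + ?q)"
      unfolding bil_combine[OF sym] N_combine bil_P by simp
    have "0 \<le> N ?w + bil S b ?w ?w" by (rule contr)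
    then have 2: "0 \<le> (c\<^sup>2 * N f - 2 * c * ?p + ?q) + (c\<^sup>2 * ?p - 2 * c * ?q + ?r)"
      unfolding bil_combine[OF sym] N_combine bil_P by simp
    have "(1 + c) * (?p * (1 - c) + ?q) \<le> (1 + c) * (c * N f)"
      using 1 2 by (simp add: power2_eq_square algebra_simps)
    then have "?p * (1 - c) + ?q \<le> c * N f" using c by simp
    then show ?thesis using bochner'[of f] by (simp add: algebra_simps)
  qed
  \<comment> \<open>Passing from c to c / (2 - c) sends 1 / k to 1 / (2 k - 1), so the excess of k
    over 1 doubles in each round.\<close>
  have "bil S b f f * (1 + 2 ^ n * \<epsilon> / 2) \<le> N f" if "perp f" for n f
    using that
  proof (induction n arbitrary: f)
    case 0
    show ?case
    proof (cases "0 \<le> bil S b f f")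
      case True
      have "bil S b f f * (1 + \<epsilon> / 2) \<le> (1 - \<epsilon> / 2) * N f * (1 + \<epsilon> / 2)"
        using gap[OF 0] \<epsilon>(1) by (intro mult_right_mono) auto
      also have "\<dots> = N f - (\<epsilon> / 2)\<^sup>2 * N f"
        by (simp add: power2_eq_square algebra_simps)
      also have "\<dots> \<le> N f" using N_nonneg by simp
      finally show ?thesis by simp
    next
      case False
      then have "bil S b f f * (1 + \<epsilon> / 2) \<le> 0" using \<epsilon>(1) by (simp add: mult_nonpos_nonneg)
      then show ?thesis using N_nonneg[of f] by simp
    qed
  next
    case (Suc n)
    let ?k = "1 + 2 ^ n * \<epsilon> / 2"
    have k: "0 < ?k" using \<epsilon>(1) by (simp add: add_pos_pos)
    have "bil S b f f * (2 - 1 / ?k) \<le> 1 / ?k * N f"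
      using Suc k by (intro improve) (auto simp: pos_le_divide_eq)
    then have "?k * (bil S b f f * (2 - 1 / ?k)) \<le> ?k * (1 / ?k * N f)"
      using k by (intro mult_left_mono) auto
    then have "bil S b f f * (2 * ?k - 1) \<le> N f"
      using k by (simp only: right_diff_distrib mult.left_commute[of ?k]) simp
    then show ?case by (simp add: algebra_simps)
  qed
  then have iter: "bil S b f f * (1 + 2 ^ n * \<epsilon> / 2) \<le> N f" if "perp f" for n f
    using that by blast
  have neg: "bil S b f f \<le> 0" if "perp f" for f
  proof (rule ccontr)
    assume "\<not> bil S b f f \<le> 0"
    then have p: "0 < bil S b f f * \<epsilon> / 2" using \<epsilon>(1) by simp
    obtain n where "N f / (bil S b f f * \<epsilon> / 2) < 2 ^ n"
      using real_arch_pow[of 2] by auto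
    then have "N f < 2 ^ n * (bil S b f f * \<epsilon> / 2)" using p by (simp only: pos_divide_less_eq)
    also have "\<dots> \<le> bil S b f f * (1 + 2 ^ n * \<epsilon> / 2)"
      using \<open>\<not> bil S b f f \<le> 0\<close> by (simp add: algebra_simps)
    finally show False using iter[OF that, of n] by simp
  qed
  define D m where "D = (\<Sum>i\<in>S. d i)" and "m = (\<Sum>i\<in>S. d i * f i)"
  have D: "0 < D" unfolding D_def using dpos fin z by (intro sum_pos) auto
  \<comment> \<open>The projection of \<open>f\<close> orthogonal to the constants, scaled by
    \<open>D\<close> to avoid a division.\<close>
  let ?g = "\<lambda>i. D * f i + (- m) * 1"
  have "(\<Sum>i\<in>S. d i * ?g i) = D * (\<Sum>i\<in>S. d i * f i) - m * (\<Sum>i\<in>S. d i)"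
    by (simp add: algebra_simps sum_subtractf sum_distrib_left)
  then have "perp ?g" unfolding perp_def by (simp add: D_def m_def)
  then have "bil S b ?g ?g \<le> 0" by (rule neg)
  moreover have "bil S b ?g ?g = D * (D * bil S b f f - m\<^sup>2)"
    unfolding bil_combine[OF sym, of D f "- m" "\<lambda>_. 1"] bil_one
    by (simp add: power2_eq_square algebra_simps D_def[symmetric] m_def[symmetric])
  ultimately have "D * bil S b f f \<le> m\<^sup>2"
    using D by (simp add: mult_le_0_iff)
  then show ?thesis unfolding bil_one by (simp add: mult.commute D_def m_def)
qed

text \<open>Substituting v = h f turns \<open>a\<close> into edge weights \<open>b\<close> and
  \<open>h\<close> into the constant function 1, which reduces the claim to the Markov
  chain.\<close>

lemma bochner_hyperbolic:
  fixes a :: "'i \<Rightarrow> 'i \<Rightarrow> real"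
  assumes fin: "finite S" and sym: "symmetric_on S a"
    and nonneg: "\<And>i j. i \<in> S \<Longrightarrow> j \<in> S \<Longrightarrow> 0 \<le> a i j"
    and z: "z \<in> S" and star: "\<And>i. i \<in> S \<Longrightarrow> 0 < a i z"
    and h: "\<And>i. i \<in> S \<Longrightarrow> 0 < h i"
    and bochner: "\<And>v. bil S a v v \<le> (\<Sum>i\<in>S. h i * (\<Sum>j\<in>S. a i j * v j)\<^sup>2 / (\<Sum>j\<in>S. a i j * h j))"
  shows "hyperbolic S a"
proof (rule hyperbolicI[OF sym, of h])
  define b where "b = (\<lambda>i j. h i * a i j * h j)"
  have bil_b: "bil S b f g = bil S a (\<lambda>i. h i * f i) (\<lambda>i. h i * g i)" for f g
    by (simp add: bil_def b_def mult_ac)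
  have symb: "symmetric_on S b" using sym by (auto simp: symmetric_on_def b_def)
  have nonnegb: "0 \<le> b i j" if "i \<in> S" "j \<in> S" for i j
    using that nonneg h by (auto simp: b_def intro!: mult_nonneg_nonneg intro: less_imp_le)
  have starb: "0 < b i z" if "i \<in> S" for i
    using that star h z by (auto simp: b_def)
  have bochnerb: "bil S b f f \<le> (\<Sum>i\<in>S. (\<Sum>j\<in>S. b i j * f j)\<^sup>2 / (\<Sum>j\<in>S. b i j))" for f
  proof -
    have "bil S b f f \<le> (\<Sum>i\<in>S. h i * (\<Sum>j\<in>S. a i j * (h j * f j))\<^sup>2 / (\<Sum>j\<in>S. a i j * h j))"
      unfolding bil_b by (rule bochner)
    also have "\<dots> = (\<Sum>i\<in>S. (\<Sum>j\<in>S. b i j * f j)\<^sup>2 / (\<Sum>j\<in>S. b i j))"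
    proof (rule sum.cong)
      fix i assume i: "i \<in> S"
      have 1: "(\<Sum>j\<in>S. b i j * f j) = h i * (\<Sum>j\<in>S. a i j * (h j * f j))"
        by (simp add: b_def sum_distrib_left mult_ac)
      have 2: "(\<Sum>j\<in>S. b i j) = h i * (\<Sum>j\<in>S. a i j * h j)"
        by (simp add: b_def sum_distrib_left mult_ac)
      show "h i * (\<Sum>j\<in>S. a i j * (h j * f j))\<^sup>2 / (\<Sum>j\<in>S. a i j * h j) =
          (\<Sum>j\<in>S. b i j * f j)\<^sup>2 / (\<Sum>j\<in>S. b i j)"
        unfolding 1 2 using h[OF i] by (simp add: power2_eq_square)
    qed simp
    finally show ?thesis .
  qed
  note key = markov_hyperbolic[OF fin symb nonnegb z starb bochnerb]
  show "bil S a v v * bil S a h h \<le> (bil S a v h)\<^sup>2" for v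
  proof -
    have "bil S a (\<lambda>i. h i * (v i / h i)) w = bil S a v w" for w
      unfolding bil_def using h by (intro sum.cong) (auto simp: less_imp_neq[symmetric])
    then have "bil S a v w = bil S a (\<lambda>i. h i * (v i / h i)) w" for w by simp
    moreover have "bil S a v v = bil S a (\<lambda>i. h i * (v i / h i)) (\<lambda>i. h i * (v i / h i))"
      by (metis calculation bil_commute[OF sym])
    ultimately show ?thesis
      using key[of "\<lambda>i. v i / h i"] unfolding bil_b by simp
  qed
  show "0 < bil S a h h"
    unfolding bil_rows
    by (intro sum_pos mult_pos_pos sum_pos2[OF fin z] h mult_nonneg_nonneg nonneg star fin)
      (use z h in \<open>auto intro: less_imp_le\<close>)
qed

subsection \<open>Weights of continuations\<close>

locale weighted_poset =
  fixes X :: "'a set" and R :: "'a \<Rightarrow> 'a \<Rightarrow> bool" and \<omega> :: "'a \<Rightarrow> real"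
  assumes finite_X: "finite X"
    and poset: "strict_poset_on X R"
    and weight_pos: "x \<in> X \<Longrightarrow> 0 < \<omega> x"
begin

text \<open>Which words continue a feasible word depends only on its letter set, a down-set; so the
  inductions run over ideals instead of words.\<close>

definition ideal :: "'a set \<Rightarrow> bool" where
  "ideal I \<longleftrightarrow> I \<subseteq> X \<and> (\<forall>x\<in>I. \<forall>y\<in>X. R y x \<longrightarrow> y \<in> I)"

definition avail :: "'a set \<Rightarrow> 'a set" where
  "avail I = {x \<in> X. x \<notin> I \<and> (\<forall>y\<in>X. R y x \<longrightarrow> y \<in> I)}"

abbreviation desc :: "'a set \<Rightarrow> 'a \<Rightarrow> 'a set" where
  "desc I x \<equiv> avail (insert x I) - avail I"

text \<open>The total weight of all words of length \<open>m\<close> that continue a feasible word with letter set \<open>I\<close>.\<close>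
fun contw :: "nat \<Rightarrow> 'a set \<Rightarrow> real" where
  "contw 0 I = 1"
| "contw (Suc m) I = (\<Sum>x\<in>avail I. \<omega> x * contw m (insert x I))"

lemma avail_subset: "avail I \<subseteq> X"
  by (auto simp: avail_def)

lemma finite_avail [simp]: "finite (avail I)"
  using finite_X avail_subset finite_subset by blast

lemma availD: "x \<in> avail I \<Longrightarrow> x \<in> X" "x \<in> avail I \<Longrightarrow> x \<notin> I"
  by (auto simp: avail_def)

lemma weight_pos_avail: "x \<in> avail I \<Longrightarrow> 0 < \<omega> x"
  using weight_pos availD by blast

lemma avail_insertI: "y \<in> avail I \<Longrightarrow> y \<noteq> x \<Longrightarrow> y \<in> avail (insert x I)"
  by (auto simp: avail_def)

lemma self_notin_avail_insert [simp]:
  "x \<notin> avail (insert x I)" "x \<notin> avail (insert y (insert x I))"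
  by (auto simp: avail_def)

lemma desc_above: "y \<in> desc I x \<Longrightarrow> R x y"
  by (auto simp: avail_def)

lemma avail_insert: "avail (insert x I) = (avail I - {x}) \<union> desc I x"
  by (auto simp: avail_def)

lemma ideal_empty: "ideal {}"
  by (simp add: ideal_def)

lemma ideal_insert: "ideal I \<Longrightarrow> x \<in> avail I \<Longrightarrow> ideal (insert x I)"
  by (auto simp: ideal_def avail_def)

text \<open>An element strictly between \<open>x\<close> and \<open>y\<close> would already be in
  \<open>I\<close>, and then so would \<open>x\<close>.\<close>

lemma desc_subset_Cov:
  assumes "ideal I" "x \<in> avail I"
  shows "desc I x \<subseteq> Cov X R x"
proof
  fix y assume y: "y \<in> desc I x"
  have "False" if "z \<in> X" "R x z" "R z y" for z
  proof -
    have "z \<in> insert x I" using y that by (auto simp: avail_def)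
    moreover have "z \<noteq> x" using that poset by (auto simp: strict_poset_on_def irreflp_on_def)
    ultimately have "x \<in> I" using assms that by (auto simp: ideal_def avail_def)
    then show False using assms availD by blast
  qed
  then show "y \<in> Cov X R x" using y desc_above[OF y] availD by (auto simp: Cov_def)
qed

lemma avail_nonempty:
  assumes "0 < card (X - I)"
  shows "avail I \<noteq> {}"
proof -
  have "transp_on (X - I) R" "asymp_on (X - I) R"
    using poset unfolding strict_poset_on_def irreflp_on_def transp_on_def asymp_on_def by blast+
  moreover have "finite (X - I)" "X - I \<noteq> {}" using finite_X assms by (auto simp: card_gt_0_iff)
  ultimately obtain x where "x \<in> X - I" "\<forall>y\<in>X - I. y \<noteq> x \<longrightarrow> \<not> R y x"
    using Finite_Set.bex_min_element[of "X - I" R] by metis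
  then have "x \<in> avail I"
    using poset by (auto simp: avail_def strict_poset_on_def irreflp_on_def)
  then show ?thesis by blast
qed

lemma card_diff_insert:
  assumes "x \<in> avail I" shows "Suc (card (X - insert x I)) = card (X - I)"
proof -
  have "X - insert x I = (X - I) - {x}" by auto
  moreover have "x \<in> X - I" using availD[OF assms] by simp
  ultimately show ?thesis using finite_X card_Suc_Diff1[of "X - I" x] by simp
qed

lemma contw_nonneg: "0 \<le> contw m I"
  by (induction m arbitrary: I) (auto intro!: sum_nonneg mult_nonneg_nonneg intro: less_imp_le weight_pos_avail)

lemma contw_pos: "m \<le> card (X - I) \<Longrightarrow> 0 < contw m I"
proof (induction m arbitrary: I)
  case (Suc m)
  have "0 < contw m (insert x I)" if "x \<in> avail I" for x
    using Suc card_diff_insert[OF that] by simp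
  moreover have "avail I \<noteq> {}" using Suc.prems by (intro avail_nonempty) simp
  ultimately show ?case by (auto intro!: sum_pos mult_pos_pos weight_pos_avail)
qed simp

declare contw.simps(2) [simp del]

section \<open>The symmetric matrices of an ideal and the pull inequality\<close>

definition cfun :: "'a set \<Rightarrow> nat \<Rightarrow> ('a option \<Rightarrow> real) \<Rightarrow> real" where
  "cfun I m u = (\<Sum>y\<in>avail I. \<omega> y * u (Some y) * contw m (insert y I)) + u None * contw m I"

text \<open>Carries vectors from \<open>I\<close> to \<open>insert x I\<close>: a letter released by
  \<open>x\<close> inherits the entry of \<open>x\<close>.\<close>

definition relabel :: "'a set \<Rightarrow> 'a \<Rightarrow> ('a option \<Rightarrow> real) \<Rightarrow> 'a option \<Rightarrow> real" where
  "relabel I x u i = (case i of None \<Rightarrow> u None | Some y \<Rightarrow> if y \<in> avail I then u (Some y) else u (Some x))"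

definition coords :: "'a set \<Rightarrow> 'a option set" where
  "coords I = insert None (Some ` avail I)"

text \<open>The total weight of the words \<open>xy\<beta>\<close> continuing \<open>I\<close>, where \<open>None\<close> stands for an absent letter. Words
  whose second letter is a descendant of the first cannot be swapped; they go to the diagonal.\<close>
fun cmat :: "'a set \<Rightarrow> nat \<Rightarrow> 'a option \<Rightarrow> 'a option \<Rightarrow> real" where
  "cmat I m None None = contw m I"
| "cmat I m (Some x) None = \<omega> x * contw m (insert x I)"
| "cmat I m None (Some y) = \<omega> y * contw m (insert y I)"
| "cmat I m (Some x) (Some y) = (if x = y then \<omega> x * (\<Sum>z\<in>desc I x. \<omega> z * contw m (insert z (insert x I)))
     else \<omega> x * \<omega> y * contw m (insert y (insert x I)))"

abbreviation cform :: "'a set \<Rightarrow> nat \<Rightarrow> ('a option \<Rightarrow> real) \<Rightarrow> ('a option \<Rightarrow> real) \<Rightarrow> real" where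
  "cform I m \<equiv> bil (coords I) (cmat I m)"

abbreviation const_vec :: "real \<Rightarrow> real \<Rightarrow> 'a option \<Rightarrow> real" where
  "const_vec a c \<equiv> case_option c (\<lambda>_. a)"

lemma relabel_simps [simp]: "relabel I x u None = u None"
  "relabel I x u (Some y) = (if y \<in> avail I then u (Some y) else u (Some x))"
  by (auto simp: relabel_def)

lemma relabel_const_vec [simp]: "relabel I x (const_vec a c) = const_vec a c"
  by (auto simp: relabel_def fun_eq_iff split: option.split)

lemma finite_coords [simp]: "finite (coords I)"
  by (simp add: coords_def)

lemma sum_coords: "(\<Sum>i\<in>coords I. f i) = f None + (\<Sum>x\<in>avail I. f (Some x))"
  by (subst coords_def, subst sum.insert) (auto simp: sum.reindex)

lemma symmetric_cmat: "symmetric_on (coords I) (cmat I m)"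
  unfolding symmetric_on_def
proof (intro ballI)
  show "cmat I m i j = cmat I m j i" for i j
    by (cases i; cases j) (auto simp: insert_commute)
qed

lemma row_None: "(\<Sum>j\<in>coords I. cmat I m None j * w j) = cfun I m w"
  by (simp add: sum_coords cfun_def mult_ac add.commute)

lemma sum_avail_insert:
  assumes "x \<in> avail I"
  shows "(\<Sum>y\<in>avail (insert x I). f y) = (\<Sum>y\<in>avail I - {x}. f y) + (\<Sum>y\<in>desc I x. f y)"
  by (subst avail_insert, subst sum.union_disjoint) auto

text \<open>After \<open>x\<close>, the old letters give the off-diagonal entries. The descendants
  of \<open>x\<close> all carry the entry of \<open>x\<close> under \<open>relabel\<close> and
  together form the diagonal entry.\<close>

lemma row_Some:
  assumes "x \<in> avail I"
  shows "(\<Sum>j\<in>coords I. cmat I m (Some x) j * w j) = \<omega> x * cfun (insert x I) m (relabel I x w)"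
proof -
  have "(\<Sum>y\<in>avail I. cmat I m (Some x) (Some y) * w (Some y)) =
     cmat I m (Some x) (Some x) * w (Some x) + (\<Sum>y\<in>avail I - {x}. cmat I m (Some x) (Some y) * w (Some y))"
    using assms by (simp only: sum.remove[OF finite_avail])
  also have "(\<Sum>y\<in>avail I - {x}. cmat I m (Some x) (Some y) * w (Some y)) =
     (\<Sum>y\<in>avail I - {x}. \<omega> x * \<omega> y * contw m (insert y (insert x I)) * w (Some y))"
    by (intro sum.cong) auto
  finally show ?thesis
    unfolding sum_coords cfun_def sum_avail_insert[OF assms]
    by (simp add: algebra_simps sum_distrib_left)
qed

lemma cform_rows: "cform I m v w = (\<Sum>x\<in>avail I. \<omega> x * v (Some x) * cfun (insert x I) m (relabel I x w)) + v None * cfun I m w"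
  unfolding bil_rows sum_coords[of "\<lambda>i. v i * (\<Sum>j\<in>coords I. cmat I m i j * w j)"] row_None
  by (simp add: row_Some) (simp add: mult_ac add.commute)

lemma cfun_const_vec: "cfun I m (const_vec a c) = a * contw (Suc m) I + c * contw m I"
  by (simp add: cfun_def contw.simps(2) sum_distrib_left mult_ac)

text \<open>Constant vectors are fixed by \<open>relabel\<close>, so pairing with one reduces the
  form to the linear functionals \<open>cfun\<close> for two consecutive lengths.\<close>

lemma cform_const_vec: "cform I m v (const_vec a c) = a * cfun I (Suc m) v + c * cfun I m v"
  by (simp add: cform_rows cfun_const_vec)
    (simp add: cfun_def algebra_simps sum.distrib sum_distrib_left)

lemma cform_const_const:
  "cform I m (const_vec a c) (const_vec a c) = a\<^sup>2 * contw (Suc (Suc m)) I + 2 * a * c * contw (Suc m) I + c\<^sup>2 * contw m I"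
  by (simp only: cform_const_vec cfun_const_vec) (simp add: power2_eq_square algebra_simps)

lemma cmat_nonneg: "i \<in> coords I \<Longrightarrow> j \<in> coords I \<Longrightarrow> 0 \<le> cmat I m i j"
  by (cases i; cases j)
    (auto simp: coords_def intro!: mult_nonneg_nonneg sum_nonneg contw_nonneg intro: less_imp_le weight_pos_avail)

text \<open>Both sides are sums over feasible continuations \<open>xyz\<close>. The triples not accounted for by
  relabelling come in pairs \<open>xyz\<close>, \<open>yxz\<close> where \<open>z\<close> needs both \<open>x\<close> and \<open>y\<close>; such a pair contributes
  the square of \<open>w x - w y\<close>.\<close>
lemma pull_inequality:
  "cform I (Suc m) w w \<le> (\<Sum>x\<in>avail I. \<omega> x * cform (insert x I) m (relabel I x w) (relabel I x w))"
proof -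
  let ?V = "avail I" and ?w = "\<lambda>x. w (Some x)"
  let ?A = "\<lambda>x. avail (insert x I)" and ?B = "\<lambda>x y. avail (insert y (insert x I))"
  define g where "g = (\<lambda>x y. \<omega> x * \<omega> y * contw m (insert y (insert x I)))"
  define G where "G = (\<lambda>x y z. \<omega> x * \<omega> y * \<omega> z * contw m (insert z (insert y (insert x I))))"
  define u where "u = (\<lambda>x y. if y \<in> ?V then ?w y else ?w x)"
  define t where "t = (\<lambda>x y z. if z \<in> ?A x then u x z else u x y)"
  let ?D = "SIGMA x : ?V. ?A x"
  define P where "P = {(x, y, z). x \<in> ?V \<and> y \<in> ?A x \<and> z \<in> ?B x y}"
  have P_Sigma: "P = (SIGMA x : ?V. SIGMA y : ?A x. ?B x y)"
    by (auto simp: P_def)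
  have finP: "finite P" unfolding P_Sigma by (intro finite_SigmaI) auto
  have sum2: "(\<Sum>x\<in>?V. \<Sum>y\<in>?A x. f x y) = (\<Sum>(x, y)\<in>?D. f x y)" for f :: "'a \<Rightarrow> 'a \<Rightarrow> real"
    by (intro sum.Sigma) auto
  have sum3: "(\<Sum>x\<in>?V. \<Sum>y\<in>?A x. \<Sum>z\<in>?B x y. f x y z) = (\<Sum>(x, y, z)\<in>P. f x y z)"
    for f :: "'a \<Rightarrow> 'a \<Rightarrow> 'a \<Rightarrow> real"
    unfolding P_Sigma by (subst sum.Sigma, simp, simp)+ (simp add: case_prod_beta')

  have relabel_u: "relabel I x w (Some y) = u x y" for x y by (simp add: u_def)
  have cfun_B: "cfun (insert y (insert x I)) m (relabel (insert x I) y (relabel I x w)) =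
      (\<Sum>z\<in>?B x y. \<omega> z * t x y z * contw m (insert z (insert y (insert x I)))) + w None * contw m (insert y (insert x I))"
    for x y
    unfolding cfun_def t_def u_def relabel_simps ..
  have cfun_A: "cfun (insert x I) k (relabel I x w) =
      (\<Sum>y\<in>?A x. \<omega> y * u x y * contw k (insert y (insert x I))) + w None * contw k (insert x I)" for x k
    by (simp add: cfun_def u_def)

  have "(\<Sum>x\<in>?V. \<omega> x * cform (insert x I) m (relabel I x w) (relabel I x w)) =
    (\<Sum>x\<in>?V. \<Sum>y\<in>?A x. \<Sum>z\<in>?B x y. G x y z * (u x y * t x y z))
    + 2 * w None * (\<Sum>x\<in>?V. \<Sum>y\<in>?A x. g x y * u x y) + (w None)\<^sup>2 * contw (Suc m) I"
    unfolding cform_rows cfun_B cfun_A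
    by (simp add: relabel_u contw.simps(2) G_def g_def power2_eq_square algebra_simps sum.distrib sum_distrib_left
        del: relabel_simps(2))
  moreover have "cform I (Suc m) w w =
    (\<Sum>x\<in>?V. \<Sum>y\<in>?A x. \<Sum>z\<in>?B x y. G x y z * (?w x * u x y))
    + w None * (\<Sum>x\<in>?V. \<Sum>y\<in>?A x. g x y * ?w x)
    + w None * (\<Sum>x\<in>?V. \<Sum>y\<in>?A x. g x y * ?w x) + (w None)\<^sup>2 * contw (Suc m) I"
    unfolding cform_rows cfun_A unfolding cfun_def
    by (simp add: contw.simps(2) G_def g_def power2_eq_square algebra_simps sum.distrib sum_distrib_left)
  \<comment> \<open>The terms linear in \<open>w None\<close> agree: \<open>u x y\<close> can differ
    from \<open>?w x\<close> only if both letters are available at \<open>I\<close>, and there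
    swapping them preserves \<open>g\<close>.\<close>
  moreover have "(\<Sum>x\<in>?V. \<Sum>y\<in>?A x. g x y * u x y) = (\<Sum>x\<in>?V. \<Sum>y\<in>?A x. g x y * ?w x)"
  proof -
    let ?D1 = "{p \<in> ?D. snd p \<in> ?V}"
    have D1: "?D1 = {(x, y). x \<in> ?V \<and> y \<in> ?V \<and> x \<noteq> y}"
      by (auto intro: avail_insertI)
    have "(\<Sum>x\<in>?V. \<Sum>y\<in>?A x. g x y * u x y) - (\<Sum>x\<in>?V. \<Sum>y\<in>?A x. g x y * ?w x)
        = (\<Sum>p\<in>?D. g (fst p) (snd p) * (u (fst p) (snd p) - ?w (fst p)))"
      unfolding sum2 by (simp add: sum_subtractf[symmetric] case_prod_beta' right_diff_distrib)
    also have "\<dots> = (\<Sum>p\<in>?D1. g (fst p) (snd p) * (u (fst p) (snd p) - ?w (fst p)))"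
      by (intro sum.mono_neutral_right) (auto simp: u_def)
    also have "\<dots> = (\<Sum>p\<in>?D1. g (fst p) (snd p) * ?w (snd p)) - (\<Sum>p\<in>?D1. g (fst p) (snd p) * ?w (fst p))"
      by (simp add: sum_subtractf[symmetric] right_diff_distrib u_def)
    also have "(\<Sum>p\<in>?D1. g (fst p) (snd p) * ?w (snd p)) = (\<Sum>p\<in>?D1. g (fst p) (snd p) * ?w (fst p))"
      unfolding D1
      by (rule sum.reindex_bij_witness[of _ prod.swap prod.swap]) (auto simp: g_def insert_commute)
    finally show ?thesis by simp
  qed
  moreover have "(\<Sum>x\<in>?V. \<Sum>y\<in>?A x. \<Sum>z\<in>?B x y. G x y z * (?w x * u x y)) \<le>
      (\<Sum>x\<in>?V. \<Sum>y\<in>?A x. \<Sum>z\<in>?B x y. G x y z * (u x y * t x y z))"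
  proof -
    have G_perm: "G y x z = G x y z" "G x z y = G x y z" for x y z
      by (simp_all add: G_def insert_commute mult_ac)
    define h where "h = (\<lambda>(x, y, z). G x y z * (u x y * t x y z - ?w x * u x y))"
    define Pa where "Pa = {(x, y, z) \<in> P. y \<in> ?V \<and> z \<in> ?V}"
    define Pc where "Pc = {(x, y, z) \<in> P. y \<in> ?V \<and> z \<notin> ?V \<and> z \<notin> ?A x \<and> z \<in> ?A y}"
    define Pe where "Pe = {(x, y, z) \<in> P. y \<in> ?V \<and> z \<notin> ?V \<and> z \<notin> ?A x \<and> z \<notin> ?A y}"
    define Pd where "Pd = {(x, y, z) \<in> P. y \<notin> ?V \<and> z \<in> ?V}"
    have sub: "Pa \<union> Pc \<union> Pe \<union> Pd \<subseteq> P"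
      by (auto simp: Pa_def Pc_def Pd_def Pe_def)
    have fins: "finite Pa" "finite Pc" "finite Pe" "finite Pd"
      using sub finP by (auto intro: finite_subset)
    have disj: "Pa \<inter> Pc = {}" "(Pa \<union> Pc) \<inter> Pe = {}" "(Pa \<union> Pc \<union> Pe) \<inter> Pd = {}"
      by (auto simp: Pa_def Pc_def Pd_def Pe_def)
    \<comment> \<open>Outside the four classes the entries inherited through \<open>relabel\<close>
      all coincide with that of \<open>x\<close>, or \<open>z\<close> inherits from \<open>x\<close>
      directly, so the two products are equal.\<close>
    have zero: "h p = 0" if p: "p \<in> P - (Pa \<union> Pc \<union> Pe \<union> Pd)" for p
    proof -
      obtain x y z where xyz: "p = (x, y, z)" by (cases p)
      consider "y \<in> ?V" "z \<notin> ?V" "z \<in> ?A x" | "y \<notin> ?V" "z \<notin> ?V"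
        using p unfolding xyz Pa_def Pc_def Pd_def Pe_def by blast
      then show ?thesis by cases (simp_all add: xyz h_def t_def u_def)
    qed
    have "sum h P = sum h (Pa \<union> Pc \<union> Pe \<union> Pd)"
      using sub finP zero by (intro sum.mono_neutral_right) auto
    also have "\<dots> = sum h Pa + sum h Pc + sum h Pe + sum h Pd"
      using fins disj by (simp add: sum.union_disjoint)
    finally have split: "sum h P = sum h Pa + sum h Pc + sum h Pe + sum h Pd" .

    have Pa: "Pa = {(x, y, z). x \<in> ?V \<and> y \<in> ?V \<and> z \<in> ?V \<and> x \<noteq> y \<and> x \<noteq> z \<and> y \<noteq> z}"
      by (auto simp: Pa_def P_def intro!: avail_insertI)
    \<comment> \<open>If all three letters are available at once, reversing the word exchanges the
      two products.\<close>
    have "sum h Pa = (\<Sum>(x, y, z)\<in>Pa. G x y z * ?w y * ?w z) - (\<Sum>(x, y, z)\<in>Pa. G x y z * ?w y * ?w x)"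
      unfolding sum_subtractf[symmetric]
    proof (intro sum.cong refl, clarify)
      fix x y z assume "(x, y, z) \<in> Pa"
      then have "y \<in> ?V" "z \<in> ?V" "z \<in> ?A x" unfolding Pa by (auto intro: avail_insertI)
      then show "h (x, y, z) = G x y z * ?w y * ?w z - G x y z * ?w y * ?w x"
        by (simp add: h_def t_def u_def algebra_simps)
    qed
    also have "(\<Sum>(x, y, z)\<in>Pa. G x y z * ?w y * ?w z) = (\<Sum>(x, y, z)\<in>Pa. G x y z * ?w y * ?w x)"
      unfolding Pa
      by (rule sum.reindex_bij_witness[of _ "\<lambda>(x, y, z). (z, y, x)" "\<lambda>(x, y, z). (z, y, x)"])
        (auto simp: G_perm)
    finally have a: "sum h Pa = 0" by simp

    \<comment> \<open>If \<open>z\<close> is released by \<open>y\<close> alone, then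
      \<open>yzx\<close> is feasible too, and this rotation matches the two classes with opposite
      signs.\<close>
    have "sum h Pc = (\<Sum>p\<in>Pd. - h p)"
    proof (rule sum.reindex_bij_witness[of _ "\<lambda>(x, y, z). (z, x, y)" "\<lambda>(x, y, z). (y, z, x)"])
      fix p assume "p \<in> Pd"
      then obtain x y z where p: "p = (x, y, z)" "x \<in> ?V" "y \<in> ?A x" "y \<notin> ?V" "z \<in> ?V" "z \<in> ?B x y"
        by (auto simp: Pd_def P_def)
      then have "x \<noteq> z" "y \<noteq> z" "x \<noteq> y" by (auto simp: avail_def)
      moreover have "y \<notin> ?A z" using p \<open>x \<noteq> z\<close> desc_above[of y x I] by (auto simp: avail_def)
      moreover have "y \<in> ?B z x" using p \<open>y \<noteq> z\<close> avail_insertI[of y "insert x I" z] by (simp add: insert_commute)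
      ultimately show "(case p of (x, y, z) \<Rightarrow> (z, x, y)) \<in> Pc"
        using p by (auto simp: Pc_def P_def intro: avail_insertI)
    next
      fix p assume "p \<in> Pc"
      then obtain x y z where p: "p = (x, y, z)" "x \<in> ?V" "y \<in> ?V" "z \<notin> ?V" "z \<in> ?A y" "z \<notin> ?A x"
          "y \<in> ?A x" "z \<in> ?B x y"
        by (auto simp: Pc_def P_def)
      have neq: "x \<noteq> y" "x \<noteq> z" using p by auto
      show "(case p of (x, y, z) \<Rightarrow> (y, z, x)) \<in> Pd"
        using p neq by (auto simp: Pd_def P_def intro!: avail_insertI)
      show "- h (case p of (x, y, z) \<Rightarrow> (y, z, x)) = h p"
        using p neq avail_insertI[of x I y] by (simp add: h_def G_perm t_def u_def algebra_simps)
    qed auto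
    then have cd: "sum h Pc + sum h Pd = 0" by (simp add: sum_negf)

    have "sum h Pe = (\<Sum>p\<in>Pe. h (case p of (x, y, z) \<Rightarrow> (y, x, z)))"
      by (rule sum.reindex_bij_witness[of _ "\<lambda>(x, y, z). (y, x, z)" "\<lambda>(x, y, z). (y, x, z)"])
        (auto simp: Pe_def P_def insert_commute intro: avail_insertI)
    then have "2 * sum h Pe = (\<Sum>p\<in>Pe. h p + h (case p of (x, y, z) \<Rightarrow> (y, x, z)))"
      by (simp add: sum.distrib)
    also have "\<dots> = (\<Sum>(x, y, z)\<in>Pe. G x y z * (?w x - ?w y)\<^sup>2)"
    proof (intro sum.cong refl, clarify)
      fix x y z assume "(x, y, z) \<in> Pe"
      then have "x \<in> ?V" "y \<in> ?V" "z \<notin> ?A x" "z \<notin> ?A y" by (auto simp: Pe_def P_def)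
      then show "h (x, y, z) + h (y, x, z) = G x y z * (?w x - ?w y)\<^sup>2"
        by (simp add: h_def t_def u_def G_perm power2_eq_square algebra_simps)
    qed
    also have "\<dots> \<ge> 0"
      by (intro sum_nonneg)
        (auto simp: Pe_def P_def G_def intro!: mult_nonneg_nonneg contw_nonneg intro: less_imp_le weight_pos_avail)
    finally have "0 \<le> sum h P" using a cd split by simp
    moreover have "sum h P = (\<Sum>(x, y, z)\<in>P. G x y z * (u x y * t x y z)) - (\<Sum>(x, y, z)\<in>P. G x y z * (?w x * u x y))"
      unfolding sum_subtractf[symmetric] h_def
      by (intro sum.cong) (simp_all add: case_prod_beta' right_diff_distrib)
    ultimately show ?thesis unfolding sum3 by simp
  qed
  ultimately show ?thesis by (simp add: algebra_simps)
qed

section \<open>Feasible words and their letter sets\<close>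

lemma feasible_snoc: "feasible X R (\<alpha> @ [x]) \<longleftrightarrow> feasible X R \<alpha> \<and> x \<in> avail (set \<alpha>)"
proof -
  have "(\<forall>i<length (\<alpha> @ [x]). \<forall>y\<in>X. R y ((\<alpha> @ [x]) ! i) \<longrightarrow> (\<exists>j<i. (\<alpha> @ [x]) ! j = y)) \<longleftrightarrow>
     (\<forall>i<length \<alpha>. \<forall>y\<in>X. R y (\<alpha> ! i) \<longrightarrow> (\<exists>j<i. \<alpha> ! j = y)) \<and> (\<forall>y\<in>X. R y x \<longrightarrow> y \<in> set \<alpha>)"
  proof -
    have "(\<exists>j<i. (\<alpha> @ [x]) ! j = y) \<longleftrightarrow> (\<exists>j<i. \<alpha> ! j = y)" if "i \<le> length \<alpha>" for i y
      using that by (intro ex_cong) (auto simp: nth_append)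
    then show ?thesis by (simp add: All_less_Suc nth_append in_set_conv_nth conj_commute)
  qed
  then show ?thesis unfolding feasible_def by (auto simp: avail_def)
qed

lemma ideal_set: "feasible X R \<alpha> \<Longrightarrow> ideal (set \<alpha>)"
proof (induction \<alpha> rule: rev_induct)
  case Nil
  show ?case by (simp add: ideal_empty)
next
  case (snoc x \<alpha>)
  then show ?case using ideal_insert[of "set \<alpha>" x] by (simp add: feasible_snoc)
qed

lemma Cont_eq: "feasible X R \<alpha> \<Longrightarrow> Cont X R \<alpha> = avail (set \<alpha>)"
  using avail_subset by (auto simp: Cont_def feasible_words_def feasible_snoc)

lemma Des_eq:
  assumes "feasible X R \<alpha>" "x \<in> avail (set \<alpha>)"
  shows "Des X R \<alpha> x = desc (set \<alpha>) x"
proof -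
  have "feasible X R (\<alpha> @ [x, y]) \<longleftrightarrow> y \<in> avail (insert x (set \<alpha>))" for y
    using feasible_snoc[of "\<alpha> @ [x]" y] feasible_snoc[of \<alpha> x] assms by simp
  then show ?thesis
    using assms availD by (auto simp: Des_def feasible_words_def feasible_snoc)
qed

lemma card_diff_set: "feasible X R \<alpha> \<Longrightarrow> card (X - set \<alpha>) = card X - length \<alpha>"
  by (simp add: feasible_def card_Diff_subset distinct_card)

abbreviation words :: "nat \<Rightarrow> 'a list set" where
  "words \<equiv> feasible_words_of_length X R"

lemma words_iff: "\<alpha> \<in> words j \<longleftrightarrow> feasible X R \<alpha> \<and> length \<alpha> = j"
  by (simp add: feasible_words_of_length_def feasible_words_def)

lemma words_0: "words 0 = {[]}"
  by (auto simp: words_iff feasible_def)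

lemma finite_words: "finite (words j)"
  by (rule finite_subset[OF _ finite_lists_length_eq[OF finite_X, of j]]) (auto simp: words_iff feasible_def)

lemma words_Suc: "words (Suc j) = (\<lambda>(\<alpha>, x). \<alpha> @ [x]) ` (SIGMA \<alpha> : words j. avail (set \<alpha>))"
proof -
  have "\<alpha> \<in> (\<lambda>(\<alpha>, x). \<alpha> @ [x]) ` (SIGMA \<alpha> : words j. avail (set \<alpha>))" if "\<alpha> \<in> words (Suc j)" for \<alpha>
    using that by (cases \<alpha> rule: rev_cases) (auto simp: words_iff feasible_snoc)
  then show ?thesis by (auto simp: words_iff feasible_snoc)
qed

text \<open>Splits each word after \<open>j\<close> letters. The induction on \<open>m\<close> moves
  the first letter of the continuation into the prefix, hence \<open>j\<close> is arbitrary.\<close>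

lemma L_weight_add: "L_weight X R \<omega> (j + m) = (\<Sum>\<alpha>\<in>words j. word_weight \<omega> \<alpha> * contw m (set \<alpha>))"
proof (induction m arbitrary: j)
  case 0
  show ?case by (simp add: L_weight_def)
next
  case (Suc m)
  have "L_weight X R \<omega> (j + Suc m) = (\<Sum>\<alpha>\<in>words (Suc j). word_weight \<omega> \<alpha> * contw m (set \<alpha>))"
    using Suc[of "Suc j"] by simp
  also have "\<dots> = (\<Sum>(\<alpha>, x)\<in>(SIGMA \<alpha> : words j. avail (set \<alpha>)). word_weight \<omega> \<alpha> * (\<omega> x * contw m (insert x (set \<alpha>))))"
    unfolding words_Suc
    by (subst sum.reindex) (auto simp: inj_on_def word_weight_def case_prod_beta' mult_ac)
  also have "\<dots> = (\<Sum>\<alpha>\<in>words j. word_weight \<omega> \<alpha> * contw (Suc m) (set \<alpha>))"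
    by (subst sum.Sigma[symmetric]) (auto simp: finite_words sum_distrib_left contw.simps(2))
  finally show ?case .
qed

lemma L_weight_contw: "L_weight X R \<omega> m = contw m {}"
  using L_weight_add[of 0 m] by (simp add: words_0 word_weight_def)

end

section \<open>Hyperbolicity by induction on the word length, and log-concavity\<close>

locale cover_weighted_poset = weighted_poset +
  assumes cover_bound: "x \<in> X \<Longrightarrow> (\<Sum>y\<in>Cov X R x. \<omega> y) \<le> \<omega> x"
begin

lemma finite_Cov: "finite (Cov X R x)"
  using finite_X by (simp add: Cov_def)

lemma desc_weight_le_Cov:
  assumes "ideal I" "x \<in> avail I"
  shows "(\<Sum>y\<in>desc I x. \<omega> y) \<le> (\<Sum>y\<in>Cov X R x. \<omega> y)"
  using desc_subset_Cov[OF assms] weight_pos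
  by (intro sum_mono2) (auto simp: finite_Cov, auto simp: Cov_def intro: less_imp_le)

lemma desc_weight_le:
  assumes "ideal I" "x \<in> avail I"
  shows "(\<Sum>y\<in>desc I x. \<omega> y) \<le> \<omega> x"
  using desc_weight_le_Cov[OF assms] cover_bound[of x] availD[OF assms(2)] by simp

text \<open>For \<open>m = 0\<close> every factor \<open>contw\<close> is 1, so only the diagonal of
  the matrix deviates from a rank-one matrix.\<close>

lemma cform_0:
  "cform I 0 v w = ((\<Sum>x\<in>avail I. \<omega> x * v (Some x)) + v None) * ((\<Sum>x\<in>avail I. \<omega> x * w (Some x)) + w None)
    - (\<Sum>x\<in>avail I. \<omega> x * (\<omega> x - (\<Sum>y\<in>desc I x. \<omega> y)) * v (Some x) * w (Some x))"
proof -
  define L where "L = (\<Sum>x\<in>avail I. \<omega> x * w (Some x)) + w None"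
  define c where "c = (\<lambda>x. \<omega> x - (\<Sum>y\<in>desc I x. \<omega> y))"
  have row: "cfun (insert x I) 0 (relabel I x w) = L - c x * w (Some x)" if "x \<in> avail I" for x
  proof -
    have "cfun (insert x I) 0 (relabel I x w) =
        (\<Sum>y\<in>avail I - {x}. \<omega> y * w (Some y)) + (\<Sum>y\<in>desc I x. \<omega> y) * w (Some x) + w None"
      unfolding cfun_def sum_avail_insert[OF that] by (simp add: sum_distrib_right)
    moreover have "(\<Sum>y\<in>avail I. \<omega> y * w (Some y)) = \<omega> x * w (Some x) + (\<Sum>y\<in>avail I - {x}. \<omega> y * w (Some y))"
      using that by (simp only: sum.remove[OF finite_avail])
    ultimately show ?thesis by (simp add: L_def c_def algebra_simps)
  qed
  have "cfun I 0 w = L" by (simp add: cfun_def L_def)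
  then have "cform I 0 v w = (\<Sum>x\<in>avail I. \<omega> x * v (Some x) * (L - c x * w (Some x))) + v None * L"
    unfolding cform_rows by (simp add: row)
  also have "\<dots> = ((\<Sum>x\<in>avail I. \<omega> x * v (Some x)) + v None) * L
    - (\<Sum>x\<in>avail I. \<omega> x * c x * v (Some x) * w (Some x))"
    by (simp add: algebra_simps sum_subtractf sum_distrib_left)
  finally show ?thesis unfolding L_def c_def .
qed

lemma hyperbolic_0:
  assumes "ideal I"
  shows "hyperbolic (coords I) (cmat I 0)"
proof (rule hyperbolicI[OF symmetric_cmat])
  show "0 < cform I 0 (const_vec 0 1) (const_vec 0 1)" unfolding cform_const_const by simp
  fix v
  let ?l = "(\<Sum>x\<in>avail I. \<omega> x * v (Some x)) + v None"
  have "0 \<le> (\<Sum>x\<in>avail I. \<omega> x * (\<omega> x - (\<Sum>y\<in>desc I x. \<omega> y)) * v (Some x) * v (Some x))"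
    using desc_weight_le[OF assms] weight_pos_avail
    by (intro sum_nonneg, subst mult.assoc) (intro mult_nonneg_nonneg[OF mult_nonneg_nonneg], auto intro: less_imp_le)
  then have "cform I 0 v v \<le> ?l\<^sup>2" unfolding cform_0 by (simp add: power2_eq_square)
  moreover have "cform I 0 v (const_vec 0 1) = ?l" unfolding cform_const_vec by (simp add: cfun_def)
  ultimately show "cform I 0 v v * cform I 0 (const_vec 0 1) (const_vec 0 1) \<le> (cform I 0 v (const_vec 0 1))\<^sup>2"
    unfolding cform_const_const by simp
qed

text \<open>Every row of the mixed matrix is a pairing with \<open>h\<close> in a form for
  \<open>m\<close>. The pull inequality and reversed Cauchy-Schwarz in those forms give the Bochner
  hypothesis; \<open>0 < t < 1\<close> makes \<open>h\<close> positive in every coordinate.\<close>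

lemma hyperbolic_interpolation:
  assumes I: "Suc m < card (X - I)"
    and here: "hyperbolic (coords I) (cmat I m)"
    and above: "\<And>x. x \<in> avail I \<Longrightarrow> hyperbolic (coords (insert x I)) (cmat (insert x I) m)"
    and t: "0 < t" "t < 1"
  shows "hyperbolic (coords I) (\<lambda>i j. t * cmat I (Suc m) i j + (1 - t) * cmat I m i j)" (is "hyperbolic _ ?A")
proof -
  define h :: "'a option \<Rightarrow> real" where "h = const_vec t (1 - t)"
  have Qh_pos: "0 < cform J m h h" if "m \<le> card (X - J)" for J
    unfolding h_def cform_const_const using t contw_pos[OF that] contw_nonneg[of _ J]
    by (intro add_nonneg_pos add_nonneg_nonneg mult_nonneg_nonneg mult_pos_pos) auto
  have card_above: "m \<le> card (X - insert x I)" if "x \<in> avail I" for x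
    using card_diff_insert[OF that] I by simp
  have A_row: "(\<Sum>j\<in>coords I. ?A i j * v j) =
      t * (\<Sum>j\<in>coords I. cmat I (Suc m) i j * v j) + (1 - t) * (\<Sum>j\<in>coords I. cmat I m i j * v j)" for i v
    unfolding distrib_right sum.distrib sum_distrib_left by (simp only: mult.assoc)
  have A_None: "(\<Sum>j\<in>coords I. ?A None j * v j) = cform I m v h" for v
    unfolding h_def cform_const_vec A_row row_None ..
  have A_Some: "(\<Sum>j\<in>coords I. ?A (Some x) j * v j) = \<omega> x * cform (insert x I) m (relabel I x v) h"
    if "x \<in> avail I" for x v
    unfolding h_def cform_const_vec A_row row_Some[OF that] by (simp add: algebra_simps)
  have Th: "relabel I x h = h" for x unfolding h_def by simp
  have rcs: "cform J m v v \<le> (cform J m v h)\<^sup>2 / cform J m h h"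
    if "hyperbolic (coords J) (cmat J m)" "m \<le> card (X - J)" for J v
    using that Qh_pos unfolding hyperbolic_def by (simp add: pos_le_divide_eq)
  show ?thesis
  proof (rule bochner_hyperbolic[of "coords I" ?A None h])
    show "symmetric_on (coords I) ?A"
      using symmetric_cmat[of I m] symmetric_cmat[of I "Suc m"] by (auto simp: symmetric_on_def)
    show "0 \<le> ?A i j" if "i \<in> coords I" "j \<in> coords I" for i j
      using that t by (intro add_nonneg_nonneg mult_nonneg_nonneg cmat_nonneg) auto
    show "0 < ?A i None" if "i \<in> coords I" for i
    proof (cases i)
      case None
      then show ?thesis using t I contw_pos[of m I] contw_nonneg[of "Suc m" I]
        by (auto intro!: add_nonneg_pos)
    next
      case (Some x)
      then have x: "x \<in> avail I" using that by (auto simp: coords_def)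
      show ?thesis unfolding Some cmat.simps
        using t weight_pos_avail[OF x] contw_nonneg[of "Suc m" "insert x I"] contw_pos[OF card_above[OF x]]
        by (intro add_nonneg_pos mult_nonneg_nonneg mult_pos_pos) auto
    qed
    show "0 < h i" if "i \<in> coords I" for i using t by (auto simp: h_def split: option.split)
    fix v
    have "bil (coords I) ?A v v = t * cform I (Suc m) v v + (1 - t) * cform I m v v"
      by (rule bil_matrix_combine)
    also have "\<dots> \<le> t * (\<Sum>x\<in>avail I. \<omega> x * cform (insert x I) m (relabel I x v) (relabel I x v)) + (1 - t) * cform I m v v"
      using t pull_inequality by simp
    also have "\<dots> \<le> t * (\<Sum>x\<in>avail I. \<omega> x * ((cform (insert x I) m (relabel I x v) h)\<^sup>2 / cform (insert x I) m h h))
        + (1 - t) * ((cform I m v h)\<^sup>2 / cform I m h h)"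
      using t I
      by (intro add_mono mult_left_mono sum_mono rcs above here card_above)
        (auto intro: less_imp_le weight_pos_avail)
    \<comment> \<open>The coefficients \<open>t\<close> and \<open>1 - t\<close> are the entries of
      \<open>h\<close>, and the pairings are rows by \<open>A_None\<close> and
      \<open>A_Some\<close>; the factors \<open>\<omega> x\<close> cancel to one.\<close>
    also have "\<dots> = (\<Sum>i\<in>coords I. h i * (\<Sum>j\<in>coords I. ?A i j * v j)\<^sup>2 / (\<Sum>j\<in>coords I. ?A i j * h j))"
    proof -
      have "(\<Sum>i\<in>coords I. h i * (\<Sum>j\<in>coords I. ?A i j * v j)\<^sup>2 / (\<Sum>j\<in>coords I. ?A i j * h j)) =
        (1 - t) * (cform I m v h)\<^sup>2 / cform I m h h +
        (\<Sum>x\<in>avail I. t * (\<omega> x * cform (insert x I) m (relabel I x v) h)\<^sup>2 / (\<omega> x * cform (insert x I) m h h))"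
        unfolding sum_coords[of "\<lambda>i. h i * (\<Sum>j\<in>coords I. ?A i j * v j)\<^sup>2 / (\<Sum>j\<in>coords I. ?A i j * h j)"] A_None
        by (simp add: A_Some Th) (simp add: h_def)
      also have "(\<Sum>x\<in>avail I. t * (\<omega> x * cform (insert x I) m (relabel I x v) h)\<^sup>2 / (\<omega> x * cform (insert x I) m h h)) =
        t * (\<Sum>x\<in>avail I. \<omega> x * ((cform (insert x I) m (relabel I x v) h)\<^sup>2 / cform (insert x I) m h h))"
        unfolding sum_distrib_left
        using weight_pos_avail by (intro sum.cong) (auto simp: power2_eq_square less_imp_neq[symmetric])
      finally show ?thesis by simp
    qed
    finally show "bil (coords I) ?A v v \<le> \<dots>" .
  qed (auto simp: coords_def)
qed

text \<open>The step uses the hypothesis for the same \<open>m\<close> at \<open>I\<close> and at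
  every \<open>insert x I\<close>, then lets the interpolation parameter tend to 1.\<close>

lemma hyperbolic_cmat: "ideal I \<Longrightarrow> m < card (X - I) \<Longrightarrow> hyperbolic (coords I) (cmat I m)"
proof (induction m arbitrary: I)
  case 0
  then show ?case using hyperbolic_0 by simp
next
  case (Suc m)
  have "hyperbolic (coords (insert x I)) (cmat (insert x I) m)" if "x \<in> avail I" for x
    using Suc that card_diff_insert[OF that] ideal_insert by auto
  then show ?case
    using Suc by (intro hyperbolic_limit[OF hyperbolic_interpolation]) auto
qed

text \<open>Reversed Cauchy-Schwarz for \<open>const_vec 1 0\<close> and
  \<open>const_vec 0 1\<close>.\<close>

lemma contw_log_concave:
  assumes "ideal I" "m < card (X - I)"
  shows "contw (Suc (Suc m)) I * contw m I \<le> (contw (Suc m) I)\<^sup>2"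
proof -
  have "0 < cform I m (const_vec 0 1) (const_vec 0 1)"
    unfolding cform_const_const using contw_pos[of m I] assms by simp
  then have "cform I m (const_vec 1 0) (const_vec 1 0) * cform I m (const_vec 0 1) (const_vec 0 1)
      \<le> (cform I m (const_vec 1 0) (const_vec 0 1))\<^sup>2"
    using hyperbolic_cmat[OF assms] unfolding hyperbolic_def by blast
  then show ?thesis unfolding cform_const_const cform_const_vec cfun_const_vec by (simp)
qed

section \<open>Propagation of the ratio in the equality case\<close>

text \<open>In the equality case \<open>const_vec 1 (- s)\<close> is isotropic and orthogonal to a positive vector, hence
  lies in the kernel of the form; the rows of the matrix pass this on to the next letter.\<close>
lemma ratio_above:
  assumes I: "ideal I" "m < card (X - I)"
    and eq: "contw (Suc m) I = s * contw m I" "contw (Suc (Suc m)) I = s * contw (Suc m) I"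
    and x: "x \<in> avail I"
  shows "contw (Suc m) (insert x I) = s * contw m (insert x I)"
proof -
  let ?v = "const_vec 1 (- s)" and ?e = "const_vec 0 1"
  \<comment> \<open>Pairing with this unit vector reads off the row of \<open>x\<close>.\<close>
  define u :: "'a option \<Rightarrow> real" where "u = (\<lambda>i. if i = Some x then 1 else 0)"
  have "0 < cform I m ?e ?e"
    unfolding cform_const_const using contw_pos[of m I] I by simp
  moreover have "cform I m ?v ?e = 0" "cform I m ?v ?v = 0"
    unfolding cform_const_vec cfun_const_vec using eq by (simp_all)
  ultimately have "cform I m u ?v = 0"
    by (rule hyperbolic_kernel[OF symmetric_cmat hyperbolic_cmat[OF I]])
  moreover have "cform I m u ?v = \<omega> x * cfun (insert x I) m ?v"
    unfolding cform_rows using x by (simp add: u_def if_distrib[of "\<lambda>r. _ * r"] if_distrib[of "\<lambda>r. r * _"] cong: if_cong)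
  ultimately have "cfun (insert x I) m ?v = 0" using weight_pos_avail[OF x] by simp
  then show ?thesis unfolding cfun_const_vec by (simp)
qed

text \<open>\<open>ratio_above\<close> gives the ratio at \<open>insert y I\<close> only for the
  longer pair of lengths. Log-concavity makes the ratio one length below at least \<open>s\<close>
  for each \<open>y\<close>, and the weighted total at \<open>I\<close> leaves no room for a strict
  inequality.\<close>

lemma ratio_above_pred:
  assumes I: "ideal I" "Suc m < card (X - I)"
    and eq: "contw (Suc (Suc m)) I = s * contw (Suc m) I" "contw (Suc (Suc (Suc m))) I = s * contw (Suc (Suc m)) I"
    and s: "0 < s" and x: "x \<in> avail I"
  shows "contw (Suc m) (insert x I) = s * contw m (insert x I)"
proof -
  have ratio: "contw (Suc (Suc m)) (insert y I) = s * contw (Suc m) (insert y I)" if "y \<in> avail I" for y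
    using ratio_above[OF I eq that] .
  have le: "s * contw m (insert y I) \<le> contw (Suc m) (insert y I)" if y: "y \<in> avail I" for y
  proof -
    have c: "m < card (X - insert y I)" using I(2) card_diff_insert[OF y] by simp
    have "contw (Suc m) (insert y I) * (s * contw m (insert y I)) \<le> contw (Suc m) (insert y I) * contw (Suc m) (insert y I)"
      using contw_log_concave[OF ideal_insert[OF I(1) y] c] ratio[OF y] by (simp add: power2_eq_square mult_ac)
    then show ?thesis using contw_pos[of "Suc m" "insert y I"] c by (simp)
  qed
  have "(\<Sum>y\<in>avail I. \<omega> y * (contw (Suc m) (insert y I) - s * contw m (insert y I))) = contw (Suc (Suc m)) I - s * contw (Suc m) I"
    unfolding contw.simps(2)[of "Suc m" I] contw.simps(2)[of m I]
    by (simp add: algebra_simps sum_subtractf sum_distrib_left)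
  also have "\<dots> = 0" using eq by simp
  finally have "\<forall>y\<in>avail I. \<omega> y * (contw (Suc m) (insert y I) - s * contw m (insert y I)) = 0"
    using le weight_pos_avail
    by (subst (asm) sum_nonneg_eq_0_iff) (auto intro!: mult_nonneg_nonneg intro: less_imp_le)
  then have "\<omega> x * (contw (Suc m) (insert x I) - s * contw m (insert x I)) = 0" using x by blast
  then show ?thesis using weight_pos_avail[OF x] by simp
qed

section \<open>Reading off equality from words of length one and two\<close>

lemma contw_1: "contw (Suc 0) I = (\<Sum>y\<in>avail I. \<omega> y)"
  by (simp add: contw.simps(2))

lemma contw_2: "contw (Suc (Suc 0)) I = (\<Sum>y\<in>avail I. \<omega> y)\<^sup>2 - (\<Sum>x\<in>avail I. \<omega> x * (\<omega> x - (\<Sum>y\<in>desc I x. \<omega> y)))"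
proof -
  have "contw (Suc (Suc 0)) I = cform I 0 (const_vec 1 0) (const_vec 1 0)"
    unfolding cform_const_const by simp
  then show ?thesis unfolding cform_0 by (simp add: power2_eq_square)
qed

text \<open>The weight of the covers lies between that of the descendants and
  \<open>\<omega> x\<close>; as weights are positive, equal sums force equal sets.\<close>

lemma desc_eq_Cov_iff:
  assumes "ideal I" "x \<in> avail I"
  shows "(\<Sum>y\<in>desc I x. \<omega> y) = \<omega> x \<longleftrightarrow> desc I x = Cov X R x \<and> (\<Sum>y\<in>Cov X R x. \<omega> y) = \<omega> x"
proof
  assume eq: "(\<Sum>y\<in>desc I x. \<omega> y) = \<omega> x"
  then have Cov: "(\<Sum>y\<in>Cov X R x. \<omega> y) = \<omega> x"
    using desc_weight_le_Cov[OF assms] cover_bound[of x] availD[OF assms(2)] by simp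
  have "(\<Sum>y\<in>Cov X R x - desc I x. \<omega> y) = 0"
    using eq Cov by (simp add: sum_diff[OF finite_Cov desc_subset_Cov[OF assms]])
  moreover have "0 < (\<Sum>y\<in>Cov X R x - desc I x. \<omega> y)" if "Cov X R x - desc I x \<noteq> {}"
    using that finite_Cov weight_pos by (intro sum_pos) (auto, auto simp: Cov_def)
  ultimately have "Cov X R x - desc I x = {}" by fastforce
  then show "desc I x = Cov X R x \<and> (\<Sum>y\<in>Cov X R x. \<omega> y) = \<omega> x"
    using desc_subset_Cov[OF assms] Cov by blast
qed auto

text \<open>The deficit from the square is a sum of nonnegative terms, one for each available
  letter, so it vanishes termwise.\<close>

lemma contw_2_eq_iff:
  assumes "ideal I" "contw (Suc 0) I = s"
  shows "contw (Suc (Suc 0)) I = s * s \<longleftrightarrow>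
    (\<forall>x\<in>avail I. desc I x = Cov X R x \<and> (\<Sum>y\<in>Cov X R x. \<omega> y) = \<omega> x)"
proof -
  have "contw (Suc (Suc 0)) I = s * s \<longleftrightarrow> (\<Sum>x\<in>avail I. \<omega> x * (\<omega> x - (\<Sum>y\<in>desc I x. \<omega> y))) = 0"
    using assms(2) unfolding contw_2 contw_1 by (auto simp: power2_eq_square)
  also have "\<dots> \<longleftrightarrow> (\<forall>x\<in>avail I. \<omega> x * (\<omega> x - (\<Sum>y\<in>desc I x. \<omega> y)) = 0)"
    using desc_weight_le[OF assms(1)] weight_pos_avail
    by (intro sum_nonneg_eq_0_iff) (auto intro!: mult_nonneg_nonneg intro: less_imp_le)
  also have "\<dots> \<longleftrightarrow> (\<forall>x\<in>avail I. (\<Sum>y\<in>desc I x. \<omega> y) = \<omega> x)"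
    using weight_pos_avail by fastforce
  finally show ?thesis using desc_eq_Cov_iff[OF assms(1)] by simp
qed

text \<open>Both ratios are carried along, since one step needs both: each further letter of the
  prefix lowers \<open>m\<close> by one while \<open>s\<close> stays the same.\<close>

lemma ratio_words:
  assumes eq: "contw (Suc k) {} = s * contw k {}" "contw (Suc (Suc k)) {} = s * contw (Suc k) {}"
    and s: "0 < s" and k: "Suc k < card X" and jm: "j + m = k" and \<alpha>: "\<alpha> \<in> words j"
  shows "contw (Suc m) (set \<alpha>) = s * contw m (set \<alpha>) \<and> contw (Suc (Suc m)) (set \<alpha>) = s * contw (Suc m) (set \<alpha>)"
  using jm \<alpha>
proof (induction j arbitrary: m \<alpha>)
  case 0
  then show ?case using eq by (simp add: words_0)
next
  case (Suc j)
  then obtain \<beta> x where \<beta>: "\<alpha> = \<beta> @ [x]" "\<beta> \<in> words j" "x \<in> avail (set \<beta>)"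
    unfolding words_Suc by auto
  then have feas: "feasible X R \<beta>" "length \<beta> = j" by (auto simp: words_iff)
  have c: "Suc m < card (X - set \<beta>)"
    using card_diff_set[OF feas(1)] feas(2) k Suc.prems by simp
  have IH: "contw (Suc (Suc m)) (set \<beta>) = s * contw (Suc m) (set \<beta>)"
      "contw (Suc (Suc (Suc m))) (set \<beta>) = s * contw (Suc (Suc m)) (set \<beta>)"
    using Suc.IH[of "Suc m" \<beta>] Suc.prems \<beta> by auto
  show ?case
    using ratio_above[OF ideal_set[OF feas(1)] c IH \<beta>(3)]
      ratio_above_pred[OF ideal_set[OF feas(1)] c IH s \<beta>(3)] \<beta>(1) by simp
qed

text \<open>The index is shifted: \<open>k\<close> is the length of the prefixes, one less than the
  length whose weight is squared.\<close>

lemma L_weight_equality_iff: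
  assumes k: "Suc k < card X"
  shows "(L_weight X R \<omega> (Suc k))\<^sup>2 = L_weight X R \<omega> k * L_weight X R \<omega> (Suc (Suc k)) \<longleftrightarrow>
    (\<exists>s>0. \<forall>\<alpha>\<in>words k. \<forall>x\<in>Cont X R \<alpha>.
       (\<Sum>y\<in>Cont X R \<alpha>. \<omega> y) = s \<and> Des X R \<alpha> x = Cov X R x \<and> (\<Sum>y\<in>Cov X R x. \<omega> y) = \<omega> x)"
    (is "?L \<longleftrightarrow> (\<exists>s>0. ?R s)")
proof -
  have R: "?R s \<longleftrightarrow> (\<forall>\<alpha>\<in>words k. contw (Suc 0) (set \<alpha>) = s \<and> contw (Suc (Suc 0)) (set \<alpha>) = s * s)" for s
  proof (intro ball_cong refl)
    fix \<alpha> assume \<alpha>: "\<alpha> \<in> words k"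
    then have feas: "feasible X R \<alpha>" "length \<alpha> = k" by (auto simp: words_iff)
    \<comment> \<open>The condition on the sum stands under a quantifier over letters; it can be
      extracted because some letter is available.\<close>
    have ne: "avail (set \<alpha>) \<noteq> {}"
      using card_diff_set[OF feas(1)] feas(2) k by (intro avail_nonempty) simp
    then show "(\<forall>x\<in>Cont X R \<alpha>. (\<Sum>y\<in>Cont X R \<alpha>. \<omega> y) = s \<and> Des X R \<alpha> x = Cov X R x \<and>
        (\<Sum>y\<in>Cov X R x. \<omega> y) = \<omega> x) \<longleftrightarrow> contw (Suc 0) (set \<alpha>) = s \<and> contw (Suc (Suc 0)) (set \<alpha>) = s * s"
      using contw_2_eq_iff[OF ideal_set[OF feas(1)], of s]
      by (auto simp: Cont_eq[OF feas(1)] Des_eq[OF feas(1)] contw_1)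
  qed
  have pos: "0 < contw k {}" "0 < contw (Suc k) {}"
    using k by (auto intro!: contw_pos)
  show ?thesis
  proof
    assume ?L
    define s where "s = contw (Suc k) {} / contw k {}"
    have s: "0 < s" using pos unfolding s_def by (simp)
    have eq: "contw (Suc k) {} = s * contw k {}" "contw (Suc (Suc k)) {} = s * contw (Suc k) {}"
      using \<open>?L\<close> pos unfolding L_weight_contw s_def by (simp_all add: power2_eq_square field_simps)
    have "?R s" unfolding R
      using ratio_words[OF eq s k, of k 0] by simp
    then show "\<exists>s>0. ?R s" using s by blast
  next
    assume "\<exists>s>0. ?R s"
    then obtain s where "\<forall>\<alpha>\<in>words k. contw (Suc 0) (set \<alpha>) = s \<and> contw (Suc (Suc 0)) (set \<alpha>) = s * s"
      unfolding R by blast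
    \<comment> \<open>Each prefix of length \<open>k\<close> has the same factors \<open>s\<close>
      and \<open>s * s\<close> for one and two further letters, so they come out of the
      sums.\<close>
    then have "L_weight X R \<omega> (Suc k) = s * L_weight X R \<omega> k"
      "L_weight X R \<omega> (Suc (Suc k)) = s * s * L_weight X R \<omega> k"
      using L_weight_add[of k "Suc 0"] L_weight_add[of k "Suc (Suc 0)"] L_weight_add[of k 0]
      by (simp_all add: sum_distrib_left mult_ac)
    then show ?L by (simp add: power2_eq_square)
  qed
qed

end

theorem theorem1p28:
  fixes X :: "'a set" and R :: "'a \<Rightarrow> 'a \<Rightarrow> bool" and \<omega> :: "'a \<Rightarrow> real" and n k :: nat
  assumes "finite X" and "card X = n"
    and "strict_poset_on X R"
    and "\<forall>x\<in>X. \<omega> x > 0"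
    and "\<forall>x\<in>X. \<omega> x \<ge> (\<Sum>y\<in>Cov X R x. \<omega> y)"
    and "1 \<le> k" and "k < n"
  shows "(L_weight X R \<omega> k)\<^sup>2 = L_weight X R \<omega> (k - 1) * L_weight X R \<omega> (k + 1) \<longleftrightarrow>
    (\<exists>s>0. \<forall>\<alpha>\<in>feasible_words_of_length X R (k - 1). \<forall>x\<in>Cont X R \<alpha>.
       (\<Sum>y\<in>Cont X R \<alpha>. \<omega> y) = s \<and>
       Des X R \<alpha> x = Cov X R x \<and>
       (\<Sum>y\<in>Cov X R x. \<omega> y) = \<omega> x)"
proof -
  interpret cover_weighted_poset X R \<omega>
    using assms by unfold_locales auto
  show ?thesis
    using L_weight_equality_iff[of "k - 1"] assms by simp
qed

end
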